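(* Let $C$ be an open cone containing no lines, with basepoint $b\in C$. If $x,y\in\partial C\setminus\{0\}$ lie on distinct rays (i.e. $y$ is not a positive multiple of $x$), then $B(x)\cap B(y)=\emptyset$, where $B(x):=\{r_{C,x}+f: f\in\mathcal B_C\cap A_C(x)\}$.
   Context: $V$ is a finite-dimensional real vector space. An open cone is a nonempty open convex set $T\subset V$ with $\lambda T\subseteq T$ for all $\lambda>0$ and $0\notin T$; $\partial T$ is its boundary. Write $x\le_C y$ iff $y-x\in\overline C$. $M_C(y/x):=\inf\{\lambda>0:y\le_C\lambda x\}$, $F_C(y,x):=\log M_C(y/x)$, $RF_C(x,y):=F_C(y,x)$. For $p\in\partial C\setminus\{0\}$, $r_{C,p}(x):=RF_C(x,p)-RF_C(b,p)$. A sequence $(x_n)$ in $C$ converges in the Funk sense to $g$ if $F_C(\cdot,x_n)-F_C(b,x_n)\to g$ pointwise on $C$; a Funk horofunction is such a limit not of the form $F_C(\cdot,p)-F_C(b,p)$, $p\in C$; an almost-geodesic is a sequence $(x_l)$ in $C$ with, for some $\epsilon>0$, $\sum_{i=1}^l F_C(x_{i-1},x_i)\le F_C(x_0,x_l)+\epsilon$ for all $l\ge1$; $\mathcal B_C$ is the set of Funk horofunctions that are Funk-sense limits of almost-geodesics. $A_C(x)$ is the set of Funk horofunctions that are Funk-sense limits of sequences in $C$ converging to $x$ in the usual topology. *)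

theory Defs
  imports "HOL-Analysis.Analysis"
begin

definition open_cone :: "'a::euclidean_space set \<Rightarrow> bool" where
  "open_cone T \<longleftrightarrow> T \<noteq> {} \<and> open T \<and> convex T \<and>
     (\<forall>t::real. t > 0 \<longrightarrow> ((*\<^sub>R) t ` T) \<subseteq> T) \<and> 0 \<notin> T"

text \<open>C contains no (affine) lines.\<close>
definition contains_no_lines :: "'a::euclidean_space set \<Rightarrow> bool" where
  "contains_no_lines C \<longleftrightarrow> \<not> (\<exists>a v. v \<noteq> 0 \<and> (\<forall>t::real. a + t *\<^sub>R v \<in> C))"

definition cone_le :: "'a::euclidean_space set \<Rightarrow> 'a \<Rightarrow> 'a \<Rightarrow> bool" where
  "cone_le C x y \<longleftrightarrow> y - x \<in> closure C"

definition M_C :: "'a::euclidean_space set \<Rightarrow> 'a \<Rightarrow> 'a \<Rightarrow> real" where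
  "M_C C y x = Inf {t::real. t > 0 \<and> cone_le C y (t *\<^sub>R x)}"

definition F_C :: "'a::euclidean_space set \<Rightarrow> 'a \<Rightarrow> 'a \<Rightarrow> real" where
  "F_C C y x = ln (M_C C y x)"

definition RF_C :: "'a::euclidean_space set \<Rightarrow> 'a \<Rightarrow> 'a \<Rightarrow> real" where
  "RF_C C x y = F_C C y x"

definition r_C :: "'a::euclidean_space set \<Rightarrow> 'a \<Rightarrow> 'a \<Rightarrow> 'a \<Rightarrow> real" where
  "r_C C b p x = RF_C C x p - RF_C C b p"

text \<open>Funk-sense convergence of a sequence to g (pointwise on C).\<close>
definition funk_conv :: "'a::euclidean_space set \<Rightarrow> 'a \<Rightarrow> (nat \<Rightarrow> 'a) \<Rightarrow> ('a \<Rightarrow> real) \<Rightarrow> bool" where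
  "funk_conv C b xs g \<longleftrightarrow>
     (\<forall>z\<in>C. (\<lambda>n. F_C C z (xs n) - F_C C b (xs n)) \<longlonglongrightarrow> g z)"

definition funk_horofunction :: "'a::euclidean_space set \<Rightarrow> 'a \<Rightarrow> ('a \<Rightarrow> real) \<Rightarrow> bool" where
  "funk_horofunction C b g \<longleftrightarrow>
     (\<exists>xs. (\<forall>n. xs n \<in> C) \<and> funk_conv C b xs g) \<and>
     \<not> (\<exists>p\<in>C. \<forall>z\<in>C. g z = F_C C z p - F_C C b p)"

definition almost_geodesic :: "'a::euclidean_space set \<Rightarrow> (nat \<Rightarrow> 'a) \<Rightarrow> bool" where
  "almost_geodesic C xs \<longleftrightarrow> (\<forall>n. xs n \<in> C) \<and>
     (\<exists>\<epsilon>>0. \<forall>l\<ge>1. (\<Sum>i=1..l. F_C C (xs (i - 1)) (xs i)) \<le> F_C C (xs 0) (xs l) + \<epsilon>)"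

definition B_C :: "'a::euclidean_space set \<Rightarrow> 'a \<Rightarrow> ('a \<Rightarrow> real) set" where
  "B_C C b = {g. funk_horofunction C b g \<and> (\<exists>xs. almost_geodesic C xs \<and> funk_conv C b xs g)}"

definition A_C :: "'a::euclidean_space set \<Rightarrow> 'a \<Rightarrow> 'a \<Rightarrow> ('a \<Rightarrow> real) set" where
  "A_C C b x = {g. funk_horofunction C b g \<and>
     (\<exists>xs. (\<forall>n. xs n \<in> C) \<and> xs \<longlonglongrightarrow> x \<and> funk_conv C b xs g)}"

text \<open>B(x) = {r_{C,x} + f : f in B_C \<inter> A_C(x)}, as functions on C (restricted to C,
  since all these functions are only meaningful on C).\<close>
definition B_set :: "'a::euclidean_space set \<Rightarrow> 'a \<Rightarrow> 'a \<Rightarrow> ('a \<Rightarrow> real) set" where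
  "B_set C b x = {(\<lambda>z. if z \<in> C then r_C C b x z + f z else 0) | f. f \<in> B_C C b \<inter> A_C C b x}"

end

theory Submission
  imports Defs
begin

text \<open>Suppose \<open>r\<^sub>x + f = r\<^sub>y + g\<close> on \<open>C\<close>, where \<open>f\<close> is the Funk limit of a sequence
  \<open>x\<^sub>n \<rightarrow> x\<close> and \<open>g\<close> that of a sequence \<open>y\<^sub>n \<rightarrow> y\<close>. Evaluate at \<open>z = b + s x\<close>, \<open>s > 0\<close>.
  Since \<open>x\<^sub>n\<close> approaches the boundary point \<open>x\<close>, \<open>M(b/x\<^sub>n) \<rightarrow> \<infinity>\<close> while eventually
  \<open>M(z/x\<^sub>n) \<le> \<lambda> M(b/x\<^sub>n) + s\<close> for every \<open>\<lambda> > 1\<close>, so \<open>f z \<le> 0\<close>; every Funk limit is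
  \<open>\<ge> 0\<close> on \<open>b + closure C\<close>, so \<open>g z \<ge> 0\<close>. Together with \<open>M(x/z) \<le> 1/s\<close> this gives
  \<open>M(y/z) \<le> K/s\<close> for \<open>K = M(y/b)/M(x/b)\<close>, i.e. \<open>K x - y + (K/s) b \<in> closure C\<close>;
  letting \<open>s \<rightarrow> \<infinity>\<close> yields \<open>y \<le>\<^sub>C K x\<close>. Symmetrically \<open>x \<le>\<^sub>C K\<^sup>-\<^sup>1 y\<close>, and as
  \<open>closure C\<close> contains no line, \<open>y = K x\<close>.\<close>

lemma open_cone_scaleR: "open_cone C \<Longrightarrow> c \<in> C \<Longrightarrow> t > 0 \<Longrightarrow> t *\<^sub>R c \<in> C"
  unfolding open_cone_def by blast

lemma open_cone_closure_scaleR: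
  assumes "open_cone C" "u \<in> closure C" "t > 0"
  shows "t *\<^sub>R u \<in> closure C"
proof -
  have "t *\<^sub>R u \<in> closure ((*\<^sub>R) t ` C)"
    using closure_scaleR[of t C] assms(2) by blast
  moreover have "(*\<^sub>R) t ` C \<subseteq> C"
    using assms(1,3) unfolding open_cone_def by blast
  ultimately show ?thesis
    using closure_mono by blast
qed

lemma open_cone_closure_add:
  assumes "open_cone C" "u \<in> closure C" "v \<in> closure C"
  shows "u + v \<in> closure C"
proof -
  have "convex (closure C)"
    using assms(1) convex_closure unfolding open_cone_def by blast
  then have "(1/2::real) *\<^sub>R u + (1/2::real) *\<^sub>R v \<in> closure C"
    using convexD[OF _ assms(2,3), of "1/2" "1/2"] by simp
  from open_cone_closure_scaleR[OF assms(1) this, of 2] show ?thesis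
    by (simp add: scaleR_add_right)
qed

lemma open_cone_add_closure:
  assumes "open_cone C" "c \<in> C" "d \<in> closure C"
  shows "c + d \<in> C"
proof -
  have C: "open C" "convex C"
    using assms(1) unfolding open_cone_def by auto
  have "2 *\<^sub>R c \<in> interior C"
    using open_cone_scaleR[OF assms(1,2), of 2] C interior_open by auto
  moreover have "2 *\<^sub>R d \<in> closure C"
    using open_cone_closure_scaleR[OF assms(1,3), of 2] by simp
  ultimately have "2 *\<^sub>R d - (1/2::real) *\<^sub>R (2 *\<^sub>R d - 2 *\<^sub>R c) \<in> interior C"
    by (intro mem_interior_closure_convex_shrink[OF C(2)]) simp_all
  also have "2 *\<^sub>R d - (1/2::real) *\<^sub>R (2 *\<^sub>R d - 2 *\<^sub>R c) = c + d"
    by (simp add: scaleR_diff_right scaleR_2)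
  finally show ?thesis
    using interior_open[OF C(1)] by simp
qed

lemma open_cone_closure_pointed:
  assumes "open_cone C" "contains_no_lines C" "v \<in> closure C" "- v \<in> closure C"
  shows "v = 0"
proof (rule ccontr)
  assume "v \<noteq> 0"
  obtain c where c: "c \<in> C"
    using assms(1) unfolding open_cone_def by blast
  have "c + t *\<^sub>R v \<in> C" for t :: real
  proof -
    consider "t > 0" | "t = 0" | "t < 0" by linarith
    then show ?thesis
    proof cases
      case 1
      then show ?thesis
        using open_cone_add_closure[OF assms(1) c open_cone_closure_scaleR[OF assms(1,3)]] by simp
    next
      case 2
      then show ?thesis using c by simp
    next
      case 3
      then have "(-t) *\<^sub>R (-v) \<in> closure C"
        using open_cone_closure_scaleR[OF assms(1,4), of "-t"] by simp
      then show ?thesis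
        using open_cone_add_closure[OF assms(1) c] by simp
    qed
  qed
  with \<open>v \<noteq> 0\<close> show False
    using assms(2) unfolding contains_no_lines_def by blast
qed

lemma cone_le_scaled_antisym:
  assumes "open_cone C" "contains_no_lines C" "K > 0"
    and "cone_le C y (K *\<^sub>R x)" "cone_le C x (inverse K *\<^sub>R y)"
  shows "y = K *\<^sub>R x"
proof -
  have le: "K *\<^sub>R x - y \<in> closure C" "inverse K *\<^sub>R y - x \<in> closure C"
    using assms(4,5) unfolding cone_le_def .
  have "K *\<^sub>R (inverse K *\<^sub>R y - x) = - (K *\<^sub>R x - y)"
    using assms(3) by (simp add: algebra_simps)
  then have "- (K *\<^sub>R x - y) \<in> closure C"
    using open_cone_closure_scaleR[OF assms(1) le(2) assms(3)] by simp
  then show ?thesis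
    using open_cone_closure_pointed[OF assms(1,2) le(1)] by simp
qed

lemma M_C_set_nonempty:
  assumes "open_cone C" "w \<in> C"
  shows "{t::real. t > 0 \<and> cone_le C y (t *\<^sub>R w)} \<noteq> {}"
proof -
  have "((\<lambda>\<epsilon>. w - \<epsilon> *\<^sub>R y) \<longlongrightarrow> w) (at_right 0)"
    by (auto intro!: tendsto_eq_intros)
  then have "eventually (\<lambda>\<epsilon>. w - \<epsilon> *\<^sub>R y \<in> C) (at_right (0::real))"
    using topological_tendstoD assms open_cone_def by blast
  then obtain \<epsilon> :: real where "\<epsilon> > 0" "w - \<epsilon> *\<^sub>R y \<in> C"
    using eventually_happens'[OF trivial_limit_at_right_real]
      eventually_conj[OF eventually_at_right_less] by blast
  then have "inverse \<epsilon> *\<^sub>R (w - \<epsilon> *\<^sub>R y) \<in> closure C"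
    using open_cone_scaleR[OF assms(1)] closure_subset by fastforce
  with \<open>\<epsilon> > 0\<close> have "inverse \<epsilon> \<in> {t::real. t > 0 \<and> cone_le C y (t *\<^sub>R w)}"
    by (simp add: cone_le_def scaleR_diff_right)
  then show ?thesis
    by blast
qed

lemma M_C_le:
  assumes "t > 0" "t *\<^sub>R w - y \<in> closure C"
  shows "M_C C y w \<le> t"
  unfolding M_C_def cone_le_def
  by (rule cInf_lower) (use assms in \<open>auto intro: bdd_belowI[of _ 0]\<close>)

lemma M_C_nonneg:
  assumes "open_cone C" "w \<in> C"
  shows "M_C C y w \<ge> 0"
  unfolding M_C_def
  by (rule cInf_greatest[OF M_C_set_nonempty[OF assms]]) simp

lemma M_C_attained:
  assumes "open_cone C" "w \<in> C"
  shows "M_C C y w *\<^sub>R w - y \<in> closure C"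
proof -
  let ?S = "{t::real. t > 0 \<and> cone_le C y (t *\<^sub>R w)}"
  have "Inf ?S \<in> closure ?S"
    by (intro closure_contains_Inf M_C_set_nonempty[OF assms]) (auto intro: bdd_belowI[of _ 0])
  moreover have "closed ((\<lambda>t::real. t *\<^sub>R w - y) -` closure C)"
    by (intro continuous_closed_vimage closed_closure continuous_intros)
  then have "closure ?S \<subseteq> (\<lambda>t. t *\<^sub>R w - y) -` closure C"
    by (intro closure_minimal) (auto simp: cone_le_def)
  ultimately show ?thesis
    unfolding M_C_def by blast
qed

lemma M_C_le_iff:
  assumes "open_cone C" "w \<in> C" "t > 0"
  shows "M_C C y w \<le> t \<longleftrightarrow> t *\<^sub>R w - y \<in> closure C"
proof
  assume le: "M_C C y w \<le> t"
  have "t *\<^sub>R w - y = (M_C C y w *\<^sub>R w - y) + (t - M_C C y w) *\<^sub>R w"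
    by (simp add: algebra_simps)
  also have "\<dots> \<in> closure C"
  proof (cases "M_C C y w = t")
    case False
    with le have "t - M_C C y w > 0" by simp
    then show ?thesis
      using open_cone_closure_add[OF assms(1) M_C_attained[OF assms(1,2)]
          open_cone_closure_scaleR[OF assms(1) _ \<open>t - M_C C y w > 0\<close>]]
        assms(2) closure_subset by blast
  qed (use M_C_attained[OF assms(1,2), of y] in simp)
  finally show "t *\<^sub>R w - y \<in> closure C" .
qed (use M_C_le assms(3) in blast)

lemma M_C_pos:
  assumes "open_cone C" "contains_no_lines C" "w \<in> C" "y \<in> closure C" "y \<noteq> 0"
  shows "M_C C y w > 0"
proof (rule ccontr)
  assume "\<not> M_C C y w > 0"
  then have "M_C C y w = 0"
    using M_C_nonneg[OF assms(1,3), of y] by linarith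
  then have "- y \<in> closure C"
    using M_C_attained[OF assms(1,3), of y] by simp
  then show False
    using open_cone_closure_pointed[OF assms(1,2,4)] assms(5) by blast
qed

lemma M_C_pos_of_mem:
  assumes "open_cone C" "contains_no_lines C" "w \<in> C" "c \<in> C"
  shows "M_C C c w > 0"
proof (rule M_C_pos[OF assms(1-3)])
  show "c \<in> closure C"
    using assms(4) closure_subset by blast
  show "c \<noteq> 0"
    using assms(1,4) unfolding open_cone_def by blast
qed

lemma M_C_mono:
  assumes "open_cone C" "contains_no_lines C" "w \<in> C" "b \<in> C" "v \<in> closure C"
  shows "M_C C b w \<le> M_C C (b + v) w"
proof -
  have pos: "M_C C (b + v) w > 0"
    using M_C_pos_of_mem[OF assms(1-3) open_cone_add_closure[OF assms(1,4,5)]] .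
  have "M_C C (b + v) w *\<^sub>R w - b = (M_C C (b + v) w *\<^sub>R w - (b + v)) + v"
    by simp
  also have "\<dots> \<in> closure C"
    using open_cone_closure_add[OF assms(1) M_C_attained[OF assms(1,3)] assms(5)] .
  finally show ?thesis
    using M_C_le[OF pos] by blast
qed

lemma M_C_tendsto_at_top_frontier:
  assumes "open_cone C" "b \<in> C" "x \<in> frontier C"
    and "\<forall>n. xs n \<in> C" "xs \<longlonglongrightarrow> x"
  shows "filterlim (\<lambda>n. M_C C b (xs n)) at_top sequentially"
  unfolding filterlim_at_top_gt[where c = 0]
proof (intro allI impI)
  fix T :: real
  assume "T > 0"
  have "x \<notin> C"
    using assms(1,3) by (simp add: frontier_def interior_open open_cone_def)
  have "T *\<^sub>R x - b \<notin> closure C"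
  proof
    assume "T *\<^sub>R x - b \<in> closure C"
    then have "T *\<^sub>R x \<in> C"
      using open_cone_add_closure[OF assms(1,2)] by fastforce
    then have "x \<in> C"
      using open_cone_scaleR[OF assms(1), of _ "inverse T"] \<open>T > 0\<close> by fastforce
    with \<open>x \<notin> C\<close> show False ..
  qed
  moreover have "(\<lambda>n. T *\<^sub>R xs n - b) \<longlonglongrightarrow> T *\<^sub>R x - b"
    by (intro tendsto_intros assms(5))
  ultimately have "eventually (\<lambda>n. T *\<^sub>R xs n - b \<in> - closure C) sequentially"
    using topological_tendstoD[OF _ open_Compl[OF closed_closure]] by blast
  then show "eventually (\<lambda>n. T \<le> M_C C b (xs n)) sequentially"
  proof eventually_elim
    case (elim n)
    then have "\<not> M_C C b (xs n) \<le> T"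
      using M_C_le_iff[OF assms(1) assms(4)[rule_format] \<open>T > 0\<close>] by simp
    then show ?case by simp
  qed
qed

lemma M_C_frontier_translate_eventually_le:
  assumes "open_cone C" "b \<in> C" "x \<in> frontier C"
    and "\<forall>n. xs n \<in> C" "xs \<longlonglongrightarrow> x" and "s > 0" "e > 0"
  shows "eventually (\<lambda>n. M_C C (b + s *\<^sub>R x) (xs n) \<le> (1 + e) * M_C C b (xs n)) sequentially"
proof -
  have "(\<lambda>n. (e/2) *\<^sub>R b - s *\<^sub>R (x - xs n)) \<longlonglongrightarrow> (e/2) *\<^sub>R b - s *\<^sub>R (x - x)"
    by (intro tendsto_intros assms(5))
  then have near: "eventually (\<lambda>n. (e/2) *\<^sub>R b - s *\<^sub>R (x - xs n) \<in> C) sequentially"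
    using topological_tendstoD open_cone_scaleR[OF assms(1,2)] assms(1,7)
    unfolding open_cone_def by fastforce
  have large: "eventually (\<lambda>n. 2 * s / e \<le> M_C C b (xs n)) sequentially"
    using M_C_tendsto_at_top_frontier[OF assms(1-5)] by (simp add: filterlim_at_top)
  show ?thesis
    using near large
  proof eventually_elim
    case (elim n)
    define w m where "w = xs n" and "m = M_C C b (xs n)"
    have w: "w \<in> C" using assms(4) w_def by blast
    have "m \<ge> 0"
      using M_C_nonneg[OF assms(1) w] m_def w_def by simp
    have "((1 + e/2) * m + s) *\<^sub>R w - (b + s *\<^sub>R x)
        = (1 + e/2) *\<^sub>R (m *\<^sub>R w - b) + ((e/2) *\<^sub>R b - s *\<^sub>R (x - w))"
      by (simp add: algebra_simps)
    also have "\<dots> \<in> closure C"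
    proof (rule open_cone_closure_add[OF assms(1)])
      show "(1 + e/2) *\<^sub>R (m *\<^sub>R w - b) \<in> closure C"
        using open_cone_closure_scaleR[OF assms(1) M_C_attained[OF assms(1) w]] assms(7)
        unfolding m_def w_def by simp
      show "(e/2) *\<^sub>R b - s *\<^sub>R (x - w) \<in> closure C"
        using elim(1) closure_subset unfolding w_def by blast
    qed
    finally have "M_C C (b + s *\<^sub>R x) w \<le> (1 + e/2) * m + s"
      by (rule M_C_le[rotated])
        (use \<open>m \<ge> 0\<close> assms(6,7) in \<open>intro add_nonneg_pos mult_nonneg_nonneg; simp\<close>)
    moreover have "s \<le> (e/2) * m"
      using elim(2) assms(7) unfolding m_def by (simp add: field_simps)
    ultimately show ?case
      unfolding w_def m_def by (simp add: algebra_simps)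
  qed
qed

lemma funk_conv_translate_nonneg:
  assumes "open_cone C" "contains_no_lines C" "b \<in> C" "v \<in> closure C"
    and "\<forall>n. ys n \<in> C" "funk_conv C b ys g"
  shows "g (b + v) \<ge> 0"
proof -
  have "(\<lambda>n. F_C C (b + v) (ys n) - F_C C b (ys n)) \<longlonglongrightarrow> g (b + v)"
    using assms(6) open_cone_add_closure[OF assms(1,3,4)] unfolding funk_conv_def by blast
  moreover have "F_C C (b + v) (ys n) - F_C C b (ys n) \<ge> 0" for n
  proof -
    have "M_C C b (ys n) > 0"
      using M_C_pos_of_mem[OF assms(1,2) assms(5)[rule_format] assms(3)] .
    then show ?thesis
      using M_C_mono[OF assms(1,2) assms(5)[rule_format] assms(3,4)] unfolding F_C_def
      by (simp add: ln_mono)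
  qed
  ultimately show ?thesis
    by (simp add: tendsto_lowerbound)
qed

lemma funk_conv_frontier_translate_nonpos:
  assumes "open_cone C" "contains_no_lines C" "b \<in> C" "x \<in> frontier C"
    and "\<forall>n. xs n \<in> C" "xs \<longlonglongrightarrow> x" "funk_conv C b xs f" and "s > 0"
  shows "f (b + s *\<^sub>R x) \<le> 0"
proof (rule field_le_epsilon)
  fix e :: real
  assume "e > 0"
  let ?z = "b + s *\<^sub>R x"
  have z: "?z \<in> C"
    using open_cone_add_closure[OF assms(1,3) open_cone_closure_scaleR[OF assms(1) _ assms(8)]]
      assms(4) by (simp add: frontier_def)
  have "(\<lambda>n. F_C C ?z (xs n) - F_C C b (xs n)) \<longlonglongrightarrow> f ?z"
    using assms(7) z unfolding funk_conv_def by blast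
  moreover have "eventually (\<lambda>n. F_C C ?z (xs n) - F_C C b (xs n) \<le> ln (1 + e)) sequentially"
    using M_C_frontier_translate_eventually_le[OF assms(1,3,4,5,6,8) \<open>e > 0\<close>]
  proof eventually_elim
    case (elim n)
    have "M_C C b (xs n) > 0" "M_C C ?z (xs n) > 0"
      using M_C_pos_of_mem[OF assms(1,2) assms(5)[rule_format]] assms(3) z by auto
    then have "ln (M_C C ?z (xs n)) \<le> ln (1 + e) + ln (M_C C b (xs n))"
      using ln_mono[OF elim] \<open>e > 0\<close> by (simp add: ln_mult)
    then show ?case
      unfolding F_C_def by simp
  qed
  ultimately have "f ?z \<le> ln (1 + e)"
    by (rule tendsto_upperbound) simp
  then show "f ?z \<le> 0 + e"
    using ln_add_one_self_le_self[of e] \<open>e > 0\<close> by simp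
qed

lemma cone_le_of_shifted_funk_limits_eq:
  assumes C: "open_cone C" "contains_no_lines C" and b: "b \<in> C"
    and x: "x \<in> frontier C" "x \<noteq> 0" and y: "y \<in> closure C" "y \<noteq> 0"
    and xs: "\<forall>n. xs n \<in> C" "xs \<longlonglongrightarrow> x" "funk_conv C b xs f"
    and ys: "\<forall>n. ys n \<in> C" "funk_conv C b ys g"
    and eq: "\<forall>z\<in>C. r_C C b x z + f z = r_C C b y z + g z"
  shows "cone_le C y ((M_C C y b / M_C C x b) *\<^sub>R x)"
proof -
  define K where "K = M_C C y b / M_C C x b"
  have x_cl: "x \<in> closure C"
    using x by (simp add: frontier_def)
  have "M_C C x b > 0" "M_C C y b > 0"
    using M_C_pos[OF C b x_cl x(2)] M_C_pos[OF C b y] by auto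
  then have "K > 0"
    unfolding K_def by simp
  have shifted: "K *\<^sub>R x - y + (K / s) *\<^sub>R b \<in> closure C" if "s > 0" for s :: real
  proof -
    define z where "z = b + s *\<^sub>R x"
    have z: "z \<in> C"
      using open_cone_add_closure[OF C(1) b open_cone_closure_scaleR[OF C(1) x_cl \<open>s > 0\<close>]]
      unfolding z_def .
    have "(1/s) *\<^sub>R z - x \<in> closure C"
      using open_cone_scaleR[OF C(1) b, of "1/s"] \<open>s > 0\<close> closure_subset
      by (auto simp: z_def algebra_simps)
    then have "M_C C x z \<le> 1/s"
      using M_C_le[of "1/s"] \<open>s > 0\<close> by simp
    moreover have "f z \<le> 0" "g z \<ge> 0"
      using funk_conv_frontier_translate_nonpos[OF C b x(1) xs \<open>s > 0\<close>]
        funk_conv_translate_nonneg[OF C b open_cone_closure_scaleR[OF C(1) x_cl \<open>s > 0\<close>] ys]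
      unfolding z_def by auto
    moreover have "ln (M_C C x z) - ln (M_C C x b) + f z = ln (M_C C y z) - ln (M_C C y b) + g z"
      using eq z unfolding r_C_def RF_C_def F_C_def by simp
    moreover have "M_C C x z > 0" "M_C C y z > 0"
      using M_C_pos[OF C z x_cl x(2)] M_C_pos[OF C z y] by auto
    ultimately have "ln (M_C C y z) \<le> ln (1/s) - ln (M_C C x b) + ln (M_C C y b)"
      using ln_mono[of "M_C C x z" "1/s"] by linarith
    also have "\<dots> = ln (K / s)"
      using \<open>s > 0\<close> \<open>M_C C x b > 0\<close> \<open>M_C C y b > 0\<close> unfolding K_def by (simp add: ln_div ln_mult)
    finally have "ln (M_C C y z) \<le> ln (K / s)" .
    then have "M_C C y z \<le> K / s"
      using \<open>M_C C y z > 0\<close> \<open>K > 0\<close> \<open>s > 0\<close> by simp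
    then have "(K / s) *\<^sub>R z - y \<in> closure C"
      using M_C_le_iff[OF C(1) z] \<open>K > 0\<close> \<open>s > 0\<close> by simp
    then show ?thesis
      using \<open>s > 0\<close> by (simp add: z_def algebra_simps)
  qed
  have "((\<lambda>s. K / s) \<longlongrightarrow> 0) at_top"
    by (rule tendsto_divide_0[OF tendsto_const filterlim_at_top_imp_at_infinity[OF filterlim_ident]])
  then have "((\<lambda>s. K *\<^sub>R x - y + (K / s) *\<^sub>R b) \<longlongrightarrow> K *\<^sub>R x - y + 0 *\<^sub>R b) at_top"
    by (intro tendsto_add tendsto_const tendsto_scaleR)
  moreover have "eventually (\<lambda>s. K *\<^sub>R x - y + (K / s) *\<^sub>R b \<in> closure C) at_top"
    using eventually_gt_at_top[of 0] by eventually_elim (rule shifted)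
  ultimately have "K *\<^sub>R x - y + 0 *\<^sub>R b \<in> closure C"
    by (intro Lim_in_closed_set[OF closed_closure _ trivial_limit_at_top_linorder])
  then show ?thesis
    unfolding K_def cone_le_def by simp
qed

lemma B_set_memE:
  assumes "h \<in> B_set C b x"
  obtains f xs where "\<forall>n. xs n \<in> C" "xs \<longlonglongrightarrow> x" "funk_conv C b xs f"
    and "\<forall>z\<in>C. h z = r_C C b x z + f z"
  using assms unfolding B_set_def A_C_def by auto

theorem mainTheorem9:
  fixes C :: "'a::euclidean_space set" and b x y :: 'a
  assumes "open_cone C" and "contains_no_lines C" and "b \<in> C"
    and "x \<in> frontier C - {0}" and "y \<in> frontier C - {0}"
    and "\<not> (\<exists>t::real. t > 0 \<and> y = t *\<^sub>R x)"
  shows "B_set C b x \<inter> B_set C b y = {}"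
proof (rule ccontr)
  assume "B_set C b x \<inter> B_set C b y \<noteq> {}"
  then obtain h where "h \<in> B_set C b x" "h \<in> B_set C b y" by blast
  then obtain f xs g ys
    where xs: "\<forall>n. xs n \<in> C" "xs \<longlonglongrightarrow> x" "funk_conv C b xs f" "\<forall>z\<in>C. h z = r_C C b x z + f z"
      and ys: "\<forall>n. ys n \<in> C" "ys \<longlonglongrightarrow> y" "funk_conv C b ys g" "\<forall>z\<in>C. h z = r_C C b y z + g z"
    by (elim B_set_memE)
  have x: "x \<in> frontier C" "x \<noteq> 0" "x \<in> closure C" and y: "y \<in> frontier C" "y \<noteq> 0" "y \<in> closure C"
    using assms(4,5) by (auto simp: frontier_def)
  define K where "K = M_C C y b / M_C C x b"
  have "K > 0"
    using M_C_pos[OF assms(1-3) x(3,2)] M_C_pos[OF assms(1-3) y(3,2)] unfolding K_def by simp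
  have "cone_le C y (K *\<^sub>R x)"
    using cone_le_of_shifted_funk_limits_eq[OF assms(1-3) x(1,2) y(3,2) xs(1-3) ys(1,3)] xs(4) ys(4)
    unfolding K_def by simp
  moreover have "cone_le C x (inverse K *\<^sub>R y)"
    using cone_le_of_shifted_funk_limits_eq[OF assms(1-3) y(1,2) x(3,2) ys(1-3) xs(1,3)] xs(4) ys(4)
    unfolding K_def by (simp add: inverse_divide)
  ultimately have "y = K *\<^sub>R x"
    using cone_le_scaled_antisym[OF assms(1,2) \<open>K > 0\<close>] by blast
  with assms(6) \<open>K > 0\<close> show False by blast
qed

end
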